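(* Let $(G,s,t)$ be a flow network with $G=(V,E)$, let $L$ be a distributive lattice, and let $c:E\to L$ be a capacity function. Let $\Phi$ be the set of all $L$-valued flows on $G$ (with respect to $c$), and let $\mathcal{C}$ be the set of all cuts separating $s$ from $t$. Then the maximal flow value from $s$ to $t$ equals the minimal cut value: $$\bigvee_{\phi\in\Phi}\operatorname{val}(\phi)\;=\;\bigwedge_{C\in\mathcal{C}}\operatorname{cap}(C).$$
   Context: A flow network is a tuple $(G,s,t)$ such that: (1) $G=(V,E)$ is a finite directed graph, with edges written as ordered pairs $(u,v)$ of vertices, without self-loops or directed cycles; (2) $s,t\in V$ are distinct vertices, called the source and the sink; (3) all edges incident to $s$ are outgoing and all edges incident to $t$ are incoming; (4) for every $v\in V\setminus\{s,t\}$ there exist directed paths in $G$ from $s$ to $v$ and from $v$ to $t$. It is assumed that $G$ has at least one directed path from $s$ to $t$ (given (1)-(4) this only excludes the case $V=\{s,t\}$, $E=\emptyset$). A cut separating $s$ from $t$ is a partition $C=(S,T)$ of $V$ with $s\in S$ and $t\in T$. For an edge $e=(u,v)\in E$, one writes $e\in C$ if $u\in S$ and $v\in T$. The capacity of a cut is $\operatorname{cap}(C)=\bigvee_{e\in C}c(e)$. An $L$-valued flow is a function $\phi:E\to L$ such that $\phi(e)\le c(e)$ for every $e\in E$ and, for every vertex $v\in V\setminus\{s,t\}$, $$\bigvee_{u:(u,v)\in E}\phi(u,v)=\bigvee_{w:(v,w)\in E}\phi(v,w).$$ The value of a flow is $\operatorname{val}(\phi)=\bigvee_{v:(s,v)\in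 E}\phi(s,v)$. A lattice is a partially ordered set in which any two elements have a join $\vee$ (least upper bound) and a meet $\wedge$ (greatest lower bound); it is distributive if $a\vee(b\wedge c)=(a\vee b)\wedge(a\vee c)$ and $a\wedge(b\vee c)=(a\wedge b)\vee(a\wedge c)$ for all $a,b,c$. The lattice $L$ is not assumed complete or bounded; the set $\Phi$ may be infinite, and the equation is read as saying that the least upper bound of $\{\operatorname{val}(\phi):\phi\in\Phi\}$ in $L$ exists and equals the right-hand side. *)

theory Defs
  imports "HOL-Library.Lub_Glb" "Graph_Theory.Pair_Digraph"
begin

(* A pair_digraph is a finite loop-free digraph whose arcs are ordered pairs of vertices;
   "apath u p v" says that p is a directed path (without repeated vertices) from u to v,
   and "cycle p" that p is a directed cycle, both given as lists of arcs. *)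
locale flow_network = pair_digraph G for G :: "'v pair_pre_digraph" +
  fixes s t :: 'v
  assumes source_in_verts: "s \<in> pverts G"
    and sink_in_verts: "t \<in> pverts G"
    and source_neq_sink: "s \<noteq> t"
    and no_cycle: "\<not> (\<exists>p. cycle p)"
    and source_outgoing: "(u, s) \<notin> parcs G"
    and sink_incoming: "(t, u) \<notin> parcs G"
    and path_from_source: "v \<in> pverts G - {s, t} \<Longrightarrow> \<exists>p. apath s p v"
    and path_to_sink: "v \<in> pverts G - {s, t} \<Longrightarrow> \<exists>p. apath v p t"
    and source_sink_path: "\<exists>p. apath s p t"

(* The lattice need not have a least or greatest element, so all joins and meets over
   edges and cuts are taken with Sup_fin and Inf_fin, which are specified only on finite
   nonempty sets.  In a flow network every index set below is finite and nonempty: inner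
   vertices have incoming and outgoing edges, the source has an outgoing edge, and a path
   from the source to the sink crosses every cut. *)

definition cuts :: "'v pair_pre_digraph \<Rightarrow> 'v \<Rightarrow> 'v \<Rightarrow> ('v set \<times> 'v set) set" where
  "cuts G s t = {(S, T). S \<union> T = pverts G \<and> S \<inter> T = {} \<and> s \<in> S \<and> t \<in> T}"

definition cut_edges :: "'v pair_pre_digraph \<Rightarrow> 'v set \<times> 'v set \<Rightarrow> ('v \<times> 'v) set" where
  "cut_edges G C = {(u, v). (u, v) \<in> parcs G \<and> u \<in> fst C \<and> v \<in> snd C}"

definition cap :: "'v pair_pre_digraph \<Rightarrow> ('v \<times> 'v \<Rightarrow> 'l::distrib_lattice)
    \<Rightarrow> 'v set \<times> 'v set \<Rightarrow> 'l" where
  "cap G c C = Sup_fin (c ` cut_edges G C)"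

(* Capacities and flows are functions on all pairs of vertices; only their values on the
   edges of G are ever used. *)
definition flows :: "'v pair_pre_digraph \<Rightarrow> 'v \<Rightarrow> 'v \<Rightarrow> ('v \<times> 'v \<Rightarrow> 'l::distrib_lattice)
    \<Rightarrow> ('v \<times> 'v \<Rightarrow> 'l) set" where
  "flows G s t c = {\<phi>.
     (\<forall>e \<in> parcs G. \<phi> e \<le> c e) \<and>
     (\<forall>v \<in> pverts G - {s, t}.
        Sup_fin {\<phi> (u, v) | u. (u, v) \<in> parcs G} =
        Sup_fin {\<phi> (v, w) | w. (v, w) \<in> parcs G})}"

definition val :: "'v pair_pre_digraph \<Rightarrow> 'v \<Rightarrow> ('v \<times> 'v \<Rightarrow> 'l::distrib_lattice) \<Rightarrow> 'l" where
  "val G s \<phi> = Sup_fin {\<phi> (s, v) | v. (s, v) \<in> parcs G}"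

end

theory Submission
  imports Defs
begin

text \<open>
  Weak duality, that the value of a flow is at most the capacity of a cut, rests on acyclicity:
  walking downstream from any edge that starts on the source side, conservation bounds the flow
  on it by the join of the flow on the edges that leave its head, and the walk cannot go on for
  ever, so in the end it is bounded by what crosses the cut (\<open>flow_le_cap\<close>).

  For the converse a single flow attains the meet of all capacities, so the supremum is even a
  maximum.  It is the join of all path flows: an edge \<open>e\<close> receives the join, over all walks \<open>p\<close>
  from source to sink that use \<open>e\<close>, of the bottleneck \<open>Inf_fin (c ` set p)\<close> of \<open>p\<close>.  It is
  conserved, because a walk that enters an inner vertex also leaves it
  (\<open>bottleneck_flow_in_flows\<close>), and its value is the join of the bottlenecks of all walks.  By
  distributivity, the meet over all cuts of the joins of their edges is the join, over all sets
  \<open>B\<close> of edges that meet every cut, of the meets over \<open>B\<close>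
  (\<open>le_if_common_lower_bounds_of_transversals_le\<close>).  Such a set contains a walk from source to
  sink, since otherwise the vertices reachable inside \<open>B\<close> would form a cut avoiding \<open>B\<close>
  (\<open>transversal_contains_walk\<close>), so its meet lies below the bottleneck of that walk.
\<close>

section \<open>Finite joins in a distributive lattice\<close>

text \<open>
  This is the law that a finite meet of finite joins is a join of meets over transversals.
  Speaking of lower bounds instead of meets lets the transversal \<open>B\<close> be empty although the
  lattice may have no top.  In the induction, \<open>z \<le> Sup_fin (c ` A)\<close> splits \<open>z\<close> into the join of the
  elements \<open>inf z (c e)\<close> with \<open>e \<in> A\<close>, and each of these is treated separately.
\<close>

lemma le_if_common_lower_bounds_of_transversals_le:
  fixes c :: "'e \<Rightarrow> 'l::distrib_lattice"
  assumes "finite F"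
    and "\<And>A. A \<in> F \<Longrightarrow> finite A \<and> A \<noteq> {}"
    and "\<And>A. A \<in> F \<Longrightarrow> z \<le> Sup_fin (c ` A)"
    and "\<And>B y. \<lbrakk>\<And>A. A \<in> F \<Longrightarrow> A \<inter> B \<noteq> {}; y \<le> z; \<And>e. e \<in> B \<Longrightarrow> y \<le> c e\<rbrakk> \<Longrightarrow> y \<le> x"
  shows "z \<le> x"
  using assms
proof (induction F arbitrary: z rule: finite_induct)
  case empty
  show ?case by (rule empty.prems(3)[of "{}"]) auto
next
  case (insert A F)
  have A: "finite A" "A \<noteq> {}" using insert.prems(1) by auto
  have piece: "inf z (c e) \<le> x" if e: "e \<in> A" for e
  proof (rule insert.IH)
    show "finite A' \<and> A' \<noteq> {}" if "A' \<in> F" for A'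
      using insert.prems(1) that by blast
    show "inf z (c e) \<le> Sup_fin (c ` A')" if "A' \<in> F" for A'
      using insert.prems(2)[of A'] that by (simp add: le_infI1)
    show "y \<le> x"
      if hits: "\<And>A'. A' \<in> F \<Longrightarrow> A' \<inter> B \<noteq> {}" and y: "y \<le> inf z (c e)"
        and lower: "\<And>e'. e' \<in> B \<Longrightarrow> y \<le> c e'" for B y
    proof (rule insert.prems(3)[of "insert e B"])
      show "A' \<inter> insert e B \<noteq> {}" if "A' \<in> insert A F" for A'
        using hits[of A'] that e by auto
    qed (use y lower in auto)
  qed
  have "z = inf z (Sup_fin (c ` A))"
    using insert.prems(2)[of A] by (simp add: inf_absorb1)
  also have "\<dots> = Sup_fin {inf z a |a. a \<in> c ` A}"
    using A by (intro inf_Sup1_distrib) auto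
  also have "\<dots> \<le> x"
  proof (rule Sup_fin.boundedI)
    show "finite {inf z a |a. a \<in> c ` A}" "{inf z a |a. a \<in> c ` A} \<noteq> {}"
      using A by auto
  qed (use piece in auto)
  finally show ?case .
qed

section \<open>Walks in a flow network\<close>

context flow_network
begin

lemma wf_downstream: "wf ((parcs G)\<inverse>)"
proof (rule finite_acyclic_wf_converse[OF pair_finite_arcs], rule acyclicI, intro allI notI)
  fix v assume "(v, v) \<in> (parcs G)\<^sup>+"
  then obtain p where "awalk v p v" "p \<noteq> []"
    using reachable1_awalk by auto
  then have "closed_w p" by (auto simp: closed_w_def)
  then show False using closed_w_imp_cycle no_cycle by blast
qed

lemma walk_passes_through:
  assumes "awalk s p t" "v \<noteq> s" "v \<noteq> t"
  shows "(\<exists>u. (u, v) \<in> set p) \<longleftrightarrow> (\<exists>w. (v, w) \<in> set p)"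
proof
  assume "\<exists>u. (u, v) \<in> set p"
  then obtain u p1 p2 where p: "p = p1 @ (u, v) # p2"
    by (auto dest: split_list)
  then have "awalk v p2 t"
    using assms(1) by (auto simp: awalk_Cons_iff)
  with \<open>v \<noteq> t\<close> obtain w p3 where "p2 = (v, w) # p3"
    by (cases p2) (auto simp: awalk_simps)
  with p show "\<exists>w. (v, w) \<in> set p" by auto
next
  assume "\<exists>w. (v, w) \<in> set p"
  then obtain w p1 p2 where p: "p = p1 @ (v, w) # p2"
    by (auto dest: split_list)
  then have walk: "awalk s p1 v"
    using assms(1) by (auto simp: awalk_Cons_iff)
  with \<open>v \<noteq> s\<close> have "p1 \<noteq> []" by (auto simp: awalk_simps)
  then obtain p3 u v' where p1: "p1 = p3 @ [(u, v')]"
    by (metis rev_exhaust surj_pair)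
  with walk have "v' = v" by (auto simp: awalk_simps)
  with p p1 show "\<exists>u. (u, v) \<in> set p" by auto
qed

lemma walk_leaves_source:
  assumes "awalk s p t"
  shows "\<exists>v. (s, v) \<in> set p"
  using assms source_neq_sink by (cases p) (auto simp: awalk_simps)

lemma walk_subset_arcs: "awalk u p v \<Longrightarrow> set p \<subseteq> parcs G"
  by (auto simp: awalk_def)

lemma walk_from_source: "v \<in> pverts G \<Longrightarrow> v \<noteq> t \<Longrightarrow> \<exists>p. awalk s p v"
  using path_from_source[of v] source_in_verts
  by (cases "v = s") (auto simp: awalk_Nil_iff intro: awalkI_apath exI[of _ "[]"])

lemma walk_to_sink: "v \<in> pverts G \<Longrightarrow> v \<noteq> s \<Longrightarrow> \<exists>p. awalk v p t"
  using path_to_sink[of v] sink_in_verts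
  by (cases "v = t") (auto simp: awalk_Nil_iff intro: awalkI_apath exI[of _ "[]"])

lemma arc_on_walk:
  assumes "e \<in> parcs G"
  shows "\<exists>p. awalk s p t \<and> e \<in> set p"
proof -
  obtain u v where e: "e = (u, v)" by (cases e)
  have "u \<noteq> t" "v \<noteq> s" using assms e source_outgoing sink_incoming by auto
  then obtain p q where "awalk s p u" "awalk v q t"
    using walk_from_source walk_to_sink assms e in_arcsD1 in_arcsD2 by metis
  then have "awalk s (p @ e # q) t"
    using assms e by (auto simp: awalk_Cons_iff)
  then show ?thesis by (intro exI[of _ "p @ e # q"]) simp
qed

lemma inner_vertex_arcs:
  assumes "v \<in> pverts G - {s, t}"
  shows "\<exists>u. (u, v) \<in> parcs G" "\<exists>w. (v, w) \<in> parcs G"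
proof -
  obtain p q where p: "awalk s p v" and q: "awalk v q t"
    using assms walk_from_source walk_to_sink by blast
  then have walk: "awalk s (p @ q) t" by auto
  have "\<exists>w. (v, w) \<in> set q"
    using q assms by (cases q) (auto simp: awalk_simps)
  then have "\<exists>w. (v, w) \<in> set (p @ q)" by auto
  then show "\<exists>u. (u, v) \<in> parcs G" "\<exists>w. (v, w) \<in> parcs G"
    using walk_passes_through[OF walk, of v] walk_subset_arcs[OF walk] assms by blast+
qed

lemma walk_ne: "awalk s p t \<Longrightarrow> p \<noteq> []"
  using walk_leaves_source by fastforce

lemma source_arcs: "\<exists>v. (s, v) \<in> parcs G"
proof -
  obtain p where "awalk s p t" using source_sink_path awalkI_apath by blast
  then show ?thesis using walk_leaves_source walk_subset_arcs by blast
qed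

section \<open>Cuts\<close>

text \<open>A set of arcs without a walk from \<open>s\<close> to \<open>t\<close> misses the cut whose source side consists of
  the vertices that it can reach from \<open>s\<close>.\<close>

lemma transversal_contains_walk:
  assumes hits: "\<And>C. C \<in> cuts G s t \<Longrightarrow> cut_edges G C \<inter> B \<noteq> {}"
  shows "\<exists>p. awalk s p t \<and> set p \<subseteq> B"
proof (rule ccontr)
  assume no_walk: "\<nexists>p. awalk s p t \<and> set p \<subseteq> B"
  define S where "S = {v. \<exists>p. awalk s p v \<and> set p \<subseteq> B}"
  have "S \<subseteq> pverts G" by (auto simp: S_def)
  moreover have "s \<in> S"
    using source_in_verts by (auto simp: S_def awalk_Nil_iff intro: exI[of _ "[]"])
  moreover have "t \<notin> S" using no_walk by (simp add: S_def)
  ultimately have "(S, pverts G - S) \<in> cuts G s t"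
    using sink_in_verts by (auto simp: cuts_def)
  from hits[OF this] obtain u v where
    arc: "(u, v) \<in> parcs G" "(u, v) \<in> B" "u \<in> S" "v \<notin> S"
    by (auto simp: cut_edges_def)
  then obtain p where "awalk s p u" "set p \<subseteq> B" by (auto simp: S_def)
  then have "awalk s (p @ [(u, v)]) v" "set (p @ [(u, v)]) \<subseteq> B"
    using arc in_arcsD2 by (auto simp: awalk_simps)
  then have "v \<in> S" unfolding S_def by blast
  with arc show False by simp
qed

lemma walk_crosses_cut:
  assumes "awalk u p v" "C \<in> cuts G s t" "u \<in> fst C" "v \<in> snd C"
  shows "set p \<inter> cut_edges G C \<noteq> {}"
  using assms
proof (induction p arbitrary: u)
  case Nil
  then show ?case by (auto simp: cuts_def awalk_simps)
next
  case (Cons e p)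
  obtain w where e: "e = (u, w)" "(u, w) \<in> parcs G" "awalk w p v"
    using Cons.prems(1) by (cases e) (auto simp: awalk_simps)
  consider "w \<in> fst C" | "w \<in> snd C"
    using e(2) in_arcsD2 Cons.prems(2) by (fastforce simp: cuts_def)
  then show ?case
  proof cases
    case 1
    then show ?thesis using Cons.IH[OF e(3)] Cons.prems by auto
  next
    case 2
    then show ?thesis using e Cons.prems by (auto simp: cut_edges_def)
  qed
qed

lemma cut_edges_finite_ne:
  assumes "C \<in> cuts G s t"
  shows "finite (cut_edges G C) \<and> cut_edges G C \<noteq> {}"
proof
  show "finite (cut_edges G C)"
    by (rule finite_subset[OF _ pair_finite_arcs]) (auto simp: cut_edges_def)
  obtain p where "awalk s p t" using source_sink_path awalkI_apath by blast
  from walk_crosses_cut[OF this assms] assms show "cut_edges G C \<noteq> {}"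
    by (auto simp: cuts_def)
qed

lemma cuts_finite_ne: "finite (cuts G s t)" "cuts G s t \<noteq> {}"
proof -
  have "cuts G s t \<subseteq> Pow (pverts G) \<times> Pow (pverts G)"
    by (auto simp: cuts_def)
  then show "finite (cuts G s t)"
    by (rule finite_subset) (simp add: pair_finite_verts)
  have "({s}, pverts G - {s}) \<in> cuts G s t"
    using source_in_verts sink_in_verts source_neq_sink by (auto simp: cuts_def)
  then show "cuts G s t \<noteq> {}" by blast
qed

section \<open>Weak duality\<close>

text \<open>The induction runs against the direction of the arcs and so rests on acyclicity: on a cycle
  inside the source side, conserved flow could circulate without ever crossing the cut.\<close>

lemma flow_edge_le_cap:
  fixes c :: "'v \<times> 'v \<Rightarrow> 'l::distrib_lattice"
  assumes flow: "\<phi> \<in> flows G s t c" and C: "C \<in> cuts G s t"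
    and "(u, v) \<in> parcs G" "u \<in> fst C"
  shows "\<phi> (u, v) \<le> cap G c C"
  using wf_downstream assms(3,4)
proof (induction v arbitrary: u rule: wf_induct_rule)
  case (less v)
  consider "v \<in> snd C" | "v \<in> fst C" "v \<in> pverts G - {s, t}"
    using less.prems C in_arcsD2 source_outgoing
    unfolding cuts_def by fastforce
  then show ?case
  proof cases
    case 1
    then have "(u, v) \<in> cut_edges G C" using less.prems by (simp add: cut_edges_def)
    then have "c (u, v) \<le> cap G c C"
      using cut_edges_finite_ne[OF C] unfolding cap_def
      by (intro Sup_fin.coboundedI) auto
    moreover have "\<phi> (u, v) \<le> c (u, v)" using flow less.prems by (simp add: flows_def)
    ultimately show ?thesis by (rule order_trans[rotated])
  next
    case 2
    have fin: "finite {\<phi> (u, v) |u. (u, v) \<in> parcs G}" "finite {\<phi> (v, w) |w. (v, w) \<in> parcs G}"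
      by (auto intro: finite_subset[OF _ finite_imageI[OF pair_finite_arcs, of \<phi>]])
    have "\<phi> (u, v) \<le> Sup_fin {\<phi> (u, v) |u. (u, v) \<in> parcs G}"
      using fin less.prems by (intro Sup_fin.coboundedI) auto
    also have "\<dots> = Sup_fin {\<phi> (v, w) |w. (v, w) \<in> parcs G}"
      using flow 2 by (simp add: flows_def)
    also have "\<dots> \<le> cap G c C"
      using fin inner_vertex_arcs(2)[OF 2(2)] less.IH 2 by (intro Sup_fin.boundedI) auto
    finally show ?thesis .
  qed
qed

lemma flow_le_cap:
  fixes c :: "'v \<times> 'v \<Rightarrow> 'l::distrib_lattice"
  assumes "\<phi> \<in> flows G s t c" "C \<in> cuts G s t"
  shows "val G s \<phi> \<le> cap G c C"
  unfolding val_def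
proof (rule Sup_fin.boundedI)
  show "finite {\<phi> (s, v) |v. (s, v) \<in> parcs G}"
    by (rule finite_subset[OF _ finite_imageI[OF pair_finite_arcs, of \<phi>]]) auto
  show "{\<phi> (s, v) |v. (s, v) \<in> parcs G} \<noteq> {}"
    using source_arcs by auto
  show "a \<le> cap G c C" if "a \<in> {\<phi> (s, v) |v. (s, v) \<in> parcs G}" for a
    using that flow_edge_le_cap[OF assms] assms(2) by (auto simp: cuts_def)
qed

section \<open>The bottleneck flow\<close>

definition bottleneck_flow :: "('v \<times> 'v \<Rightarrow> 'l::distrib_lattice) \<Rightarrow> 'v \<times> 'v \<Rightarrow> 'l" where
  "bottleneck_flow c e = Sup_fin {Inf_fin (c ` set p) |p. awalk s p t \<and> e \<in> set p}"

text \<open>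
  The join of the bottleneck flow over a set \<open>A\<close> of arcs is the join of the bottlenecks of the walks
  that meet \<open>A\<close>, here described by its upper bounds.  Two sets of arcs that meet the same walks
  therefore carry the same total flow, which yields conservation.
\<close>

lemma Sup_bottleneck_flow_le_iff:
  fixes c :: "'v \<times> 'v \<Rightarrow> 'l::distrib_lattice"
  assumes A: "A \<subseteq> parcs G" "A \<noteq> {}"
  shows "Sup_fin (bottleneck_flow c ` A) \<le> y \<longleftrightarrow>
    (\<forall>p. awalk s p t \<and> set p \<inter> A \<noteq> {} \<longrightarrow> Inf_fin (c ` set p) \<le> y)"
proof -
  have single: "bottleneck_flow c e \<le> y \<longleftrightarrow>
      (\<forall>p. awalk s p t \<and> e \<in> set p \<longrightarrow> Inf_fin (c ` set p) \<le> y)"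
    if "e \<in> A" for e
  proof -
    let ?W = "{Inf_fin (c ` set p) |p. awalk s p t \<and> e \<in> set p}"
    \<comment> \<open>A bottleneck depends only on the set of arcs of the walk, and there are finitely many such sets.\<close>
    have "?W \<subseteq> (\<lambda>P. Inf_fin (c ` P)) ` Pow (parcs G)"
      using walk_subset_arcs by auto
    then have "finite ?W"
      by (rule finite_subset) (simp add: pair_finite_arcs)
    moreover have "?W \<noteq> {}" using arc_on_walk that A by blast
    ultimately show ?thesis
      unfolding bottleneck_flow_def by (subst Sup_fin.bounded_iff) auto
  qed
  have "finite A" using A pair_finite_arcs finite_subset by blast
  then show ?thesis using A single by (subst Sup_fin.bounded_iff) auto
qed

lemma bottleneck_flow_in_flows:
  fixes c :: "'v \<times> 'v \<Rightarrow> 'l::distrib_lattice"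
  shows "bottleneck_flow c \<in> flows G s t c"
  unfolding flows_def
proof (intro CollectI conjI ballI)
  fix e assume e: "e \<in> parcs G"
  have "Sup_fin (bottleneck_flow c ` {e}) \<le> c e"
    using e by (subst Sup_bottleneck_flow_le_iff) (auto intro!: Inf_fin.coboundedI)
  then show "bottleneck_flow c e \<le> c e" by simp
next
  fix v assume v: "v \<in> pverts G - {s, t}"
  let ?f = "bottleneck_flow c"
  define In where "In = {(u, v) |u. (u, v) \<in> parcs G}"
  define Out where "Out = {(v, w) |w. (v, w) \<in> parcs G}"
  have ne: "In \<subseteq> parcs G" "In \<noteq> {}" "Out \<subseteq> parcs G" "Out \<noteq> {}"
    using inner_vertex_arcs[OF v] by (auto simp: In_def Out_def)
  have meet: "set p \<inter> In \<noteq> {} \<longleftrightarrow> set p \<inter> Out \<noteq> {}" if "awalk s p t" for p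
  proof -
    have "set p \<inter> In \<noteq> {} \<longleftrightarrow> (\<exists>u. (u, v) \<in> set p)" "set p \<inter> Out \<noteq> {} \<longleftrightarrow> (\<exists>w. (v, w) \<in> set p)"
      using walk_subset_arcs[OF that] by (auto simp: In_def Out_def)
    then show ?thesis using walk_passes_through[OF that] v by simp
  qed
  have "Sup_fin (?f ` In) \<le> y \<longleftrightarrow> Sup_fin (?f ` Out) \<le> y" for y
    using ne meet by (simp add: Sup_bottleneck_flow_le_iff cong: conj_cong)
  then have "Sup_fin (?f ` In) = Sup_fin (?f ` Out)"
    by (meson order_antisym order_refl)
  moreover have "?f ` In = {?f (u, v) |u. (u, v) \<in> parcs G}"
    "?f ` Out = {?f (v, w) |w. (v, w) \<in> parcs G}"
    by (auto simp: In_def Out_def)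
  ultimately show "Sup_fin {?f (u, v) |u. (u, v) \<in> parcs G} =
      Sup_fin {?f (v, w) |w. (v, w) \<in> parcs G}" by simp
qed

lemma walk_bottleneck_le_val:
  fixes c :: "'v \<times> 'v \<Rightarrow> 'l::distrib_lattice"
  assumes "awalk s p t"
  shows "Inf_fin (c ` set p) \<le> val G s (bottleneck_flow c)"
proof -
  define A where "A = {(s, v) |v. (s, v) \<in> parcs G}"
  have A: "A \<subseteq> parcs G" "A \<noteq> {}" using source_arcs by (auto simp: A_def)
  have "val G s (bottleneck_flow c) = Sup_fin (bottleneck_flow c ` A)"
    unfolding val_def A_def by (rule arg_cong[where f = Sup_fin]) auto
  moreover have "set p \<inter> A \<noteq> {}"
    using walk_leaves_source[OF assms] walk_subset_arcs[OF assms] by (auto simp: A_def)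
  ultimately show ?thesis
    using Sup_bottleneck_flow_le_iff[OF A, of c "val G s (bottleneck_flow c)"] assms by auto
qed

lemma min_cut_le_val_bottleneck_flow:
  fixes c :: "'v \<times> 'v \<Rightarrow> 'l::distrib_lattice"
  shows "Inf_fin (cap G c ` cuts G s t) \<le> val G s (bottleneck_flow c)"
proof (rule le_if_common_lower_bounds_of_transversals_le
    [where F = "cut_edges G ` cuts G s t" and c = c])
  show "finite (cut_edges G ` cuts G s t)" using cuts_finite_ne by simp
  show "finite A \<and> A \<noteq> {}" if "A \<in> cut_edges G ` cuts G s t" for A
    using that cut_edges_finite_ne by auto
  show "Inf_fin (cap G c ` cuts G s t) \<le> Sup_fin (c ` A)"
    if A: "A \<in> cut_edges G ` cuts G s t" for A
  proof -
    obtain C where C: "C \<in> cuts G s t" "A = cut_edges G C" using A by blast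
    then have "Inf_fin (cap G c ` cuts G s t) \<le> cap G c C"
      using cuts_finite_ne by (intro Inf_fin.coboundedI) auto
    then show ?thesis using C by (simp add: cap_def)
  qed
  show "y \<le> val G s (bottleneck_flow c)"
    if hits: "\<And>A. A \<in> cut_edges G ` cuts G s t \<Longrightarrow> A \<inter> B \<noteq> {}"
      and lower: "\<And>e. e \<in> B \<Longrightarrow> y \<le> c e" for B y
  proof -
    obtain p where p: "awalk s p t" "set p \<subseteq> B"
      using transversal_contains_walk[of B] hits by blast
    have "y \<le> Inf_fin (c ` set p)"
      using walk_ne[OF p(1)] p(2) lower by (intro Inf_fin.boundedI) auto
    also have "\<dots> \<le> val G s (bottleneck_flow c)"
      by (rule walk_bottleneck_le_val[OF p(1)])
    finally show ?thesis .
  qed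
qed

end

section \<open>Max-flow min-cut\<close>

theorem theorem6:
  fixes G :: "'v pair_pre_digraph" and s t :: 'v
    and c :: "'v \<times> 'v \<Rightarrow> 'l::distrib_lattice"
  assumes "flow_network G s t"
  shows "isLub UNIV (val G s ` flows G s t c) (Inf_fin (cap G c ` cuts G s t))"
proof -
  interpret flow_network G s t by fact
  show ?thesis
  proof (rule isLubI2)
    show "isUb UNIV (val G s ` flows G s t c) (Inf_fin (cap G c ` cuts G s t))"
      using flow_le_cap cuts_finite_ne
      by (auto simp: isUb_def setle_def intro!: Inf_fin.boundedI)
    show "Inf_fin (cap G c ` cuts G s t) <=* Collect (isUb UNIV (val G s ` flows G s t c))"
    proof (rule setgeI, rule ballI)
      fix y assume "y \<in> Collect (isUb UNIV (val G s ` flows G s t c))"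
      then have "val G s (bottleneck_flow c) \<le> y"
        using bottleneck_flow_in_flows by (auto simp: isUb_def setle_def)
      then show "Inf_fin (cap G c ` cuts G s t) \<le> y"
        using min_cut_le_val_bottleneck_flow order_trans by blast
    qed
  qed
qed

end
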